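(* Let $p \neq 2,5$ be a prime, let $a, n$ be positive integers, and let $r = p^a n \bmod z(p)$, $s = n \bmod z(p)$, and $A = \left\lfloor \frac{n(p^a - 1)}{p^{\nu_p (n)}z(p)} \right\rfloor$. Then: (i) If $p \equiv \pm 1 \pmod{5}$, then $$\nu_p \left( {p^a n \choose n}_F \right) = \frac{A}{p-1} - a\left\{ \frac{n}{p^{\nu_p (n)}z(p)} \right\} - \nu_p (A!) = \frac{s_p (A)}{p - 1} - a\left\{ \frac{n}{p^{\nu_p (n)}z(p)} \right\}.$$ (ii) If $p \equiv \pm 2 \pmod{5}$ and $a$ is even, then $$\nu_p \left( {p^a n \choose n}_F \right) = \frac{A}{p-1} - \frac{a}{2}[s \neq 0] - \nu_p (A!) = \frac{s_p (A)}{p - 1} - \frac{a}{2}[s \neq 0].$$ (iii) If $p \equiv \pm 2 \pmod{5}$ and $a$ is odd, then $$\nu_p \left( {p^a n \choose n}_F \right) = \left\lfloor \frac{A}{p - 1} \right\rfloor - \frac{a-1}{2}[s \neq 0] - \nu_p (A!) + \delta,$$ where $\delta = \left( \left\lfloor \frac{\nu_p (n)}{2} \right\rfloor + [2 \nmid \nu_p(n)][r>s] + [r < s]\,\nu_p(F_{z(p)}) \right)[r \neq s]$; equivalently, $\delta = 0$ if $r = s$, $\delta = \left\lfloor \frac{\nu_p (n)}{2} \right\rfloor + \nu_p (F_{z(p)})$ if $r < s$, and $\delta = \left\lceil \frac{\nu_p (n)}{2} \right\rceil$ if $r > s$.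
   Context: The Fibonacci sequence is $F_1=F_2=1$, $F_n=F_{n-1}+F_{n-2}$ for $n\ge 3$. For $m\ge 1$ and $1\le k\le m$ the Fibonomial coefficient is ${m \choose k}_F = \frac{F_1F_2\cdots F_m}{(F_1\cdots F_k)(F_1\cdots F_{m-k})}$ (an integer). $z(m)$, the rank of appearance of $m$, is the smallest positive integer $t$ with $m \mid F_t$. $\nu_p(x)$ is the exponent of $p$ in $x$; $s_p(n)$ is the sum of base-$p$ digits of $n$; $\{x\}=x-\lfloor x\rfloor$; $[P]$ is the Iverson bracket; $a \bmod m$ is the least nonnegative residue of $a$ modulo $m$. *)

theory Defs
  imports "HOL-Number_Theory.Number_Theory"
begin

definition fib_fact :: "nat \<Rightarrow> nat" where
  "fib_fact m = (\<Prod>i = 1..m. fib i)"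

text \<open>The natural-number division is exact for \<open>k \<le> m\<close>; see \<open>of_nat_fibonomial\<close> below.\<close>

definition fibonomial :: "nat \<Rightarrow> nat \<Rightarrow> nat" where
  "fibonomial m k = fib_fact m div (fib_fact k * fib_fact (m - k))"

definition fib_rank :: "nat \<Rightarrow> nat" where
  "fib_rank m = (LEAST t. 0 < t \<and> m dvd fib t)"

text \<open>The index set is that of the digit positions of \<open>n\<close>; it is finite only for \<open>b \<ge> 2\<close>.\<close>

definition digit_sum :: "nat \<Rightarrow> nat \<Rightarrow> nat" where
  "digit_sum b n = (\<Sum>i | b ^ i \<le> n. n div b ^ i mod b)"

lemma fib_fact_0 [simp]: "fib_fact 0 = 1"
  by (simp add: fib_fact_def)

lemma fib_fact_Suc: "fib_fact (Suc m) = fib (Suc m) * fib_fact m"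
  by (simp add: fib_fact_def)

lemma fib_fact_pos: "fib_fact m > 0"
  by (induction m) (simp_all add: fib_fact_Suc fib_neq_0_nat)

lemma fib_fact_mult_dvd: "fib_fact j * fib_fact k dvd fib_fact (j + k)"
proof (induction "j + k" arbitrary: j k)
  case 0
  then show ?case by simp
next
  case (Suc m)
  show ?case
  proof (cases "j = 0 \<or> k = 0")
    case True
    then show ?thesis by auto
  next
    case False
    then obtain i l where jk: "j = Suc i" "k = Suc l"
      by (meson not0_implies_Suc)
    have m: "m = i + Suc l" "m = Suc i + l"
      using Suc.hyps(2) jk by simp_all
    have "fib_fact i * fib_fact (Suc l) dvd fib_fact m"
      using Suc.hyps(1)[of i "Suc l"] m by simp
    then have 1: "fib_fact j * fib_fact k dvd fib (Suc i) * fib_fact m"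
      unfolding jk fib_fact_Suc[of i] by (simp add: mult.assoc mult_dvd_mono)
    have "fib_fact (Suc i) * fib_fact l dvd fib_fact m"
      using Suc.hyps(1)[of "Suc i" l] m by simp
    then have 2: "fib_fact j * fib_fact k dvd fib (Suc l) * fib_fact m"
      unfolding jk fib_fact_Suc[of l] by (simp add: mult.left_commute mult_dvd_mono)
    have "fib (Suc m) = fib (Suc (Suc l)) * fib (Suc i) + fib (Suc l) * fib i"
      using fib_add[of "Suc l" i] m by (simp add: add.commute)
    then have "fib_fact (j + k) =
        fib (Suc (Suc l)) * (fib (Suc i) * fib_fact m) + fib i * (fib (Suc l) * fib_fact m)"
      using Suc.hyps(2) by (metis fib_fact_Suc add_mult_distrib mult.assoc mult.commute)
    then show ?thesis
      using 1 2 by simp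
  qed
qed

lemma of_nat_fibonomial:
  assumes "k \<le> m"
  shows "(of_nat (fibonomial m k) :: 'a :: field_char_0) =
    of_nat (fib_fact m) / (of_nat (fib_fact k) * of_nat (fib_fact (m - k)))"
proof -
  have "fib_fact k * fib_fact (m - k) dvd fib_fact m"
    using fib_fact_mult_dvd[of k "m - k"] assms by simp
  then have "fibonomial m k * (fib_fact k * fib_fact (m - k)) = fib_fact m"
    by (simp add: fibonomial_def)
  then have "(of_nat (fib_fact m) :: 'a) =
      of_nat (fibonomial m k) * (of_nat (fib_fact k) * of_nat (fib_fact (m - k)))"
    by (metis of_nat_mult)
  moreover have "fib_fact k \<noteq> 0" "fib_fact (m - k) \<noteq> 0"
    using fib_fact_pos by simp_all
  ultimately show ?thesis
    by simp
qed

end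

theory Submission
  imports Defs
begin

text \<open>
  Let \<open>z\<close> be the rank of appearance of \<open>p\<close> and \<open>e\<close> the exponent of \<open>p\<close> in \<open>fib z\<close>. Lifting the
  exponent shows that \<open>p\<close> divides \<open>fib (j * z)\<close> with exponent \<open>e\<close> plus the exponent of \<open>p\<close> in \<open>j\<close>, and
  no other Fibonacci number, so the exponent of \<open>p\<close> in \<open>fib_fact x\<close> is \<open>e * (x div z)\<close> plus that of
  \<open>fact (x div z)\<close>. Write \<open>n = p ^ k * m\<close> with \<open>p\<close> not dividing \<open>m\<close>. Legendre's formula turns the
  exponent of the fibonomial coefficient into sums of \<open>p ^ i * n div z\<close> and of
  \<open>p ^ i * (m * (p ^ a - 1)) div z\<close>, hence into sums of residues modulo \<open>z\<close>. Quadratic reciprocity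
  gives \<open>p = 1\<close> or \<open>p = -1\<close> modulo \<open>z\<close> according to \<open>p\<close> modulo 5, so these residues are constant or
  alternate between two values with sum \<open>0\<close> or \<open>z\<close>.
\<close>

section \<open>Lifting the exponent for Fibonacci numbers\<close>

text \<open>Pascal's rule in operator form: with \<open>E\<close> the shift of \<open>g\<close>, one
  factor of \<open>(y + E) ^ Suc n\<close> is applied to \<open>g\<close> and the other
  \<open>n\<close> are left. Both inductions over binomial sums below rest on it.\<close>

lemma binomial_sum_Suc:
  fixes y :: "'a::comm_semiring_1"
  shows "(\<Sum>i\<le>Suc n. of_nat (Suc n choose i) * y ^ (Suc n - i) * g i)
    = (\<Sum>i\<le>n. of_nat (n choose i) * y ^ (n - i) * (y * g i + g (Suc i)))"
proof -
  have "(\<Sum>i\<le>n. of_nat (n choose i) * y ^ (n - i) * (y * g i))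
      = (\<Sum>i\<le>Suc n. of_nat (n choose i) * y ^ (Suc n - i) * g i)"
    by (simp add: Suc_diff_le mult_ac binomial_eq_0)
  also have "\<dots> = y ^ Suc n * g 0
      + (\<Sum>i\<le>n. of_nat (n choose Suc i) * y ^ (n - i) * g (Suc i))"
    by (subst sum.atMost_Suc_shift) simp
  finally have 1: "(\<Sum>i\<le>n. of_nat (n choose i) * y ^ (n - i) * (y * g i)) = \<dots>" .
  have "(\<Sum>i\<le>Suc n. of_nat (Suc n choose i) * y ^ (Suc n - i) * g i)
      = y ^ Suc n * g 0
        + (\<Sum>i\<le>n. of_nat (Suc n choose Suc i) * y ^ (n - i) * g (Suc i))"
    by (subst sum.atMost_Suc_shift) simp
  also have "\<dots> = y ^ Suc n * g 0
      + (\<Sum>i\<le>n. of_nat (n choose Suc i) * y ^ (n - i) * g (Suc i))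
      + (\<Sum>i\<le>n. of_nat (n choose i) * y ^ (n - i) * g (Suc i))"
    by (simp add: sum.distrib distrib_right add_ac)
  finally show ?thesis
    using 1 by (simp add: sum.distrib distrib_left)
qed

text \<open>Modulo \<open>x^2 - x - 1\<close> the power \<open>x ^ Suc m\<close> is
  \<open>fib (Suc m) * x + fib m\<close>; raising this to the power \<open>j\<close> and multiplying
  by \<open>x ^ r\<close> gives the expansion. The offset \<open>r\<close> is general because the
  induction shifts it by \<open>Suc m\<close>.\<close>

lemma fib_mult_add:
  "fib (j * Suc m + r)
    = (\<Sum>i\<le>j. (j choose i) * fib m ^ (j - i) * (fib (Suc m) ^ i * fib (i + r)))"
proof (induction j arbitrary: r)
  case 0
  show ?case by simp
next
  case (Suc j)
  have "fib (Suc j * Suc m + r) = fib (j * Suc m + (Suc m + r))"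
    by (simp add: add_ac)
  also have "\<dots> = (\<Sum>i\<le>j. (j choose i) * fib m ^ (j - i) * (fib (Suc m) ^ i * fib (i + (Suc m + r))))"
    by (rule Suc.IH)
  also have "\<dots> = (\<Sum>i\<le>j. (j choose i) * fib m ^ (j - i) *
      (fib m * (fib (Suc m) ^ i * fib (i + r)) + fib (Suc m) ^ Suc i * fib (Suc i + r)))"
  proof (rule sum.cong)
    fix i
    have "fib (i + (Suc m + r)) = fib (Suc m) * fib (Suc (i + r)) + fib m * fib (i + r)"
      using fib_add[of "i + r" m] by (simp add: add_ac)
    then show "(j choose i) * fib m ^ (j - i) * (fib (Suc m) ^ i * fib (i + (Suc m + r)))
      = (j choose i) * fib m ^ (j - i) *
      (fib m * (fib (Suc m) ^ i * fib (i + r)) + fib (Suc m) ^ Suc i * fib (Suc i + r))"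
      by (simp add: algebra_simps)
  qed simp
  also have "\<dots> = (\<Sum>i\<le>Suc j. (Suc j choose i) * fib m ^ (Suc j - i) * (fib (Suc m) ^ i * fib (i + r)))"
    using binomial_sum_Suc[of j "fib m" "\<lambda>i. fib (Suc m) ^ i * fib (i + r)"] by simp
  finally show ?case .
qed

lemma prime_not_dvd_fib_pred:
  assumes "prime p" "p dvd fib (Suc m)"
  shows "\<not> p dvd fib m"
  using coprime_fib_Suc_nat[of m] assms
  by (meson coprime_common_divisor_nat not_prime_unit coprime_common_divisor)

text \<open>In the expansion with \<open>r = 0\<close> the term \<open>i = 0\<close> vanishes, so
  \<open>fib m\<close> factors out. Modulo \<open>p\<close> the cofactor is \<open>j\<close> times a
  power of \<open>fib (m - 1)\<close>, and \<open>p\<close> divides neither.\<close>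

lemma multiplicity_fib_mult_coprime:
  fixes p :: nat
  assumes "prime p" "p dvd fib m" "m > 0" "\<not> p dvd j"
  shows "multiplicity p (fib (j * m)) = multiplicity p (fib m)"
proof -
  obtain m' where m: "m = Suc m'"
    using assms(3) gr0_implies_Suc by blast
  obtain l where j: "j = Suc l"
    using assms(4) by (metis dvd_0_right not0_implies_Suc)
  let ?x = "fib m" and ?y = "fib m'"
  have "fib (j * m) = (\<Sum>i\<le>Suc l. (j choose i) * ?y ^ (j - i) * (?x ^ i * fib i))"
    using fib_mult_add[of j m' 0] by (simp only: m j add_0_right)
  also have "\<dots> = (\<Sum>i\<le>l. (j choose Suc i) * ?y ^ (j - Suc i) * (?x ^ Suc i * fib (Suc i)))"
    by (subst sum.atMost_Suc_shift) simp
  also have "\<dots> = ?x * (\<Sum>i\<le>l. (j choose Suc i) * ?y ^ (j - Suc i) * (?x ^ i * fib (Suc i)))"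
    by (simp add: sum_distrib_left mult_ac)
  finally have eq: "fib (j * m) = ?x * (\<Sum>i\<le>l. (j choose Suc i) * ?y ^ (j - Suc i) * (?x ^ i * fib (Suc i)))"
    (is "_ = _ * ?S") .
  have "?S = j * ?y ^ l + (\<Sum>i\<in>{..l} - {0}. (j choose Suc i) * ?y ^ (j - Suc i) * (?x ^ i * fib (Suc i)))"
    by (subst sum.remove[of _ 0]) (simp_all add: j)
  moreover have "p dvd (\<Sum>i\<in>{..l} - {0}. (j choose Suc i) * ?y ^ (j - Suc i) * (?x ^ i * fib (Suc i)))"
    by (intro dvd_sum dvd_mult dvd_mult2 dvd_trans[OF assms(2) dvd_power]) auto
  moreover have "\<not> p dvd j * ?y ^ l"
    using assms prime_not_dvd_fib_pred[of p m'] m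
    by (auto simp: prime_dvd_mult_iff dest: prime_dvd_power)
  ultimately have "\<not> p dvd ?S"
    by (simp add: dvd_add_left_iff)
  then show ?thesis
    unfolding eq using assms(1)
    by (simp add: mult.commute[of ?x] multiplicity_prime_elem_times_other)
qed

text \<open>The term \<open>i = 1\<close> of the expansion is \<open>p * fib m\<close> times a
  number prime to \<open>p\<close>; every other term is divisible by \<open>p\<close> once
  more.\<close>

lemma multiplicity_fib_mult_prime:
  fixes p :: nat
  assumes "prime p" "p \<noteq> 2" "p dvd fib m" "m > 0"
  shows "multiplicity p (fib (p * m)) = Suc (multiplicity p (fib m))"
proof -
  obtain m' where m: "m = Suc m'"
    using assms(4) gr0_implies_Suc by blast
  have p3: "p \<ge> 3"
    using assms(1,2) prime_ge_2_nat[of p] by linarith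
  let ?x = "fib m" and ?y = "fib m'"
  let ?t = "\<lambda>i. (p choose i) * ?y ^ (p - i) * (?x ^ i * fib i)"
  have "fib (p * m) = (\<Sum>i\<le>p. ?t i)"
    using fib_mult_add[of p m' 0] by (simp only: m add_0_right)
  also have "\<dots> = ?t 0 + (?t 1 + (\<Sum>i\<in>{..p} - {0} - {1}. ?t i))"
    using p3 by (subst sum.remove[of _ 0], simp, simp, subst sum.remove[of _ 1]) auto
  finally have eq: "fib (p * m) = p * ?x * ?y ^ (p - 1) + (\<Sum>i\<in>{..p} - {0} - {1}. ?t i)"
    by (simp add: mult_ac)
  \<comment> \<open>For \<open>1 < i < p\<close> one factor \<open>p\<close> comes from the binomial
    coefficient and one from \<open>fib m\<close>. For \<open>i = p\<close> the coefficient is 1,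
    and \<open>fib m\<close> occurs at least three times because \<open>p\<close> is odd.\<close>
  have "p * ?x * p dvd ?t i" if i: "i \<in> {..p} - {0} - {1}" for i
  proof (cases "i = p")
    case True
    obtain q where "p = q + 3"
      using p3 by (metis le_add_diff_inverse2)
    then have "?x ^ p = ?x ^ q * (?x * ?x * ?x)"
      by (simp add: power_add power3_eq_cube)
    moreover have "p * ?x * p dvd ?x * ?x * ?x"
      using assms(3) by (simp add: mult_dvd_mono)
    ultimately show ?thesis
      by (simp add: True)
  next
    case False
    with i have "p dvd p choose i"
      using assms(1) by (intro dvd_choose_prime) auto
    moreover have "?x * p dvd ?x ^ i"
    proof -
      obtain q where "i = q + 2"
        using i by (metis DiffD1 DiffD2 One_nat_def add_2_eq_Suc' insertI1 not0_implies_Suc)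
      then show ?thesis
        using assms(3) by (simp add: power_add power2_eq_square mult_dvd_mono)
    qed
    ultimately have "p * (?x * p) dvd (p choose i) * ?x ^ i"
      by (rule mult_dvd_mono)
    then have "p * (?x * p) dvd ((p choose i) * ?x ^ i) * (?y ^ (p - i) * fib i)"
      by (rule dvd_mult2)
    then show ?thesis
      by (simp only: mult_ac)
  qed
  then have "p * ?x * p dvd (\<Sum>i\<in>{..p} - {0} - {1}. ?t i)"
    by (rule dvd_sum)
  then obtain c where "(\<Sum>i\<in>{..p} - {0} - {1}. ?t i) = p * ?x * p * c" ..
  with eq have eq': "fib (p * m) = (?y ^ (p - 1) + p * c) * (p * ?x)"
    by (simp add: algebra_simps)
  have "\<not> p dvd ?y ^ (p - 1)"
    using assms prime_not_dvd_fib_pred[of p m'] m by (auto dest: prime_dvd_power)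
  then have "\<not> p dvd ?y ^ (p - 1) + p * c"
    by (simp add: dvd_add_left_iff)
  then show ?thesis
    unfolding eq' using assms(1)
      fib_neq_0_nat[OF assms(4)] prime_gt_1_nat[OF assms(1)]
    by (simp add: multiplicity_prime_elem_times_other multiplicity_times_same)
qed

text \<open>Strong induction on \<open>j\<close>: factors \<open>p\<close> are stripped one at a
  time until the coprime case is reached.\<close>

lemma multiplicity_fib_mult:
  fixes p :: nat
  assumes "prime p" "p \<noteq> 2" "p dvd fib m" "m > 0" "j > 0"
  shows "multiplicity p (fib (j * m)) = multiplicity p (fib m) + multiplicity p j"
  using assms(5)
proof (induction j rule: less_induct)
  case (less j)
  show ?case
  proof (cases "p dvd j")
    case False
    then show ?thesis
      using multiplicity_fib_mult_coprime[OF assms(1,3,4)] by (simp add: not_dvd_imp_multiplicity_0)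
  next
    case True
    then obtain l where l: "j = p * l" ..
    then have l0: "l > 0" "l < j"
      using less.prems prime_gt_1_nat[OF assms(1)] by auto
    have "p dvd fib (l * m)"
      using assms(3) fib_gcd[of m "l * m"]
      by (metis dvd_trans dvd_triv_right gcd_dvd2 gcd_nat.absorb1)
    then have "multiplicity p (fib (p * (l * m))) = Suc (multiplicity p (fib (l * m)))"
      using assms l0 by (intro multiplicity_fib_mult_prime) auto
    then show ?thesis
      using less.IH[OF l0(2,1)] assms(1)
          l0(1) prime_gt_1_nat[OF assms(1)]
      by (simp add: l mult.assoc multiplicity_times_same)
  qed
qed

section \<open>The rank of appearance, and Fibonacci numbers modulo a prime\<close>

text \<open>The witness \<open>t\<close> ensures that the \<open>LEAST\<close> in
  \<open>fib_rank\<close> is attained. By \<open>fib_gcd\<close>, if \<open>p\<close> divides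
  \<open>fib m\<close> then it divides \<open>fib (gcd (fib_rank p) m)\<close>, so minimality forces
  this gcd to be the rank.\<close>

lemma fib_rank_dvd_iff:
  assumes "0 < t" "p dvd fib t"
  shows "p dvd fib m \<longleftrightarrow> fib_rank p dvd m"
    and "fib_rank p > 0"
proof -
  have z: "0 < fib_rank p \<and> p dvd fib (fib_rank p)"
    unfolding fib_rank_def by (rule LeastI[of _ t]) (use assms in auto)
  then show "fib_rank p > 0" ..
  show "p dvd fib m \<longleftrightarrow> fib_rank p dvd m"
  proof
    assume "p dvd fib m"
    with z have "p dvd fib (gcd (fib_rank p) m)"
      by (simp add: fib_gcd)
    moreover have "gcd (fib_rank p) m > 0"
      using z by simp
    ultimately have "fib_rank p \<le> gcd (fib_rank p) m"
      unfolding fib_rank_def by (intro Least_le) auto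
    then have "gcd (fib_rank p) m = fib_rank p"
      using z by (meson antisym dvd_imp_le gcd_dvd1)
    then show "fib_rank p dvd m"
      by (metis gcd_dvd2)
  next
    assume "fib_rank p dvd m"
    then have "gcd (fib_rank p) m = fib_rank p"
      by (simp add: gcd_nat.absorb1)
    then show "p dvd fib m"
      using z fib_gcd[of "fib_rank p" m] by (metis dvd_trans gcd_dvd2)
  qed
qed

text \<open>Binet's formula without irrationals: the two sums are the coefficient of
  \<open>sqrt 5\<close> and the rational part of \<open>(1 + sqrt 5) ^ n\<close>, and
  \<open>2 * fib (Suc n) - fib n\<close> is the Lucas number. The induction step multiplies by
  \<open>1 + sqrt 5\<close>.\<close>

lemma two_power_fib:
  fixes n :: nat
  shows "2 ^ n * int (fib n) = 2 * (\<Sum>i\<le>n. int (n choose i) * of_bool (odd i) * 5 ^ (i div 2))"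
    and "2 ^ n * (2 * int (fib (Suc n)) - int (fib n))
      = 2 * (\<Sum>i\<le>n. int (n choose i) * of_bool (even i) * 5 ^ (i div 2))"
proof (induction n)
  case 0
  { case 1 show ?case by simp }
  { case 2 show ?case by simp }
next
  case (Suc n)
  have o': "of_bool (odd (Suc i)) * 5 ^ (Suc i div 2) = (of_bool (even i) * 5 ^ (i div 2) :: int)" for i :: nat
    by (auto elim!: evenE)
  have o: "(\<Sum>i\<le>Suc n. int (Suc n choose i) * of_bool (odd i) * 5 ^ (i div 2))
      = (\<Sum>i\<le>n. int (n choose i) * of_bool (odd i) * 5 ^ (i div 2))
        + (\<Sum>i\<le>n. int (n choose i) * of_bool (even i) * 5 ^ (i div 2))"
    using binomial_sum_Suc[of n "1::int" "\<lambda>i. of_bool (odd i) * 5 ^ (i div 2)"] o'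
    by (simp only: power_one mult_1_right mult_1_left distrib_left sum.distrib sum_distrib_left mult_ac of_nat_id)
  have "of_bool (even (Suc i)) * 5 ^ (Suc i div 2) = 5 * (of_bool (odd i) * 5 ^ (i div 2) :: int)" for i :: nat
    by (cases "even i") (auto elim!: oddE)
  then have e: "(\<Sum>i\<le>Suc n. int (Suc n choose i) * of_bool (even i) * 5 ^ (i div 2))
      = (\<Sum>i\<le>n. int (n choose i) * of_bool (even i) * 5 ^ (i div 2))
        + 5 * (\<Sum>i\<le>n. int (n choose i) * of_bool (odd i) * 5 ^ (i div 2))"
    using binomial_sum_Suc[of n "1::int" "\<lambda>i. of_bool (even i) * 5 ^ (i div 2)"]
    by (simp only: power_one mult_1_right mult_1_left distrib_left sum.distrib sum_distrib_left mult_ac of_nat_id)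
  {
    case 1
    show ?case
      unfolding o distrib_left Suc[symmetric] by (simp add: algebra_simps)
  next
    case 2
    show ?case
      unfolding e distrib_left mult.left_commute[of 2 5] Suc[symmetric] by (simp add: algebra_simps)
  }
qed

text \<open>At \<open>n = p\<close> the inner binomial coefficients vanish modulo \<open>p\<close>,
  and Fermat's theorem turns \<open>2 ^ p\<close> into 2, which cancels against the factor on the
  right.\<close>

lemma fib_prime_cong:
  assumes "prime p" "p \<noteq> 2"
  shows "[int (fib p) = 5 ^ ((p - 1) div 2)] (mod int p)"
    and "[2 * int (fib (Suc p)) - int (fib p) = 1] (mod int p)"
proof -
  have p2: "p > 2"
    using assms prime_gt_1_nat[of p] by linarith
  have podd: "odd p"
    using assms p2 prime_odd_nat by blast
  have cop: "coprime 2 (int p)"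
    using podd by simp
  have "[2 ^ (p - 1) = 1] (mod p)"
    using fermat_theorem[of p 2] assms(1) p2 nat_dvd_not_less[of 2 p] by simp
  then have "[int (2 ^ (p - 1)) = int 1] (mod int p)"
    by (simp only: cong_int_iff)
  then have "[2 * 2 ^ (p - 1) = 2 * (1::int)] (mod int p)"
    by (intro cong_mult) auto
  then have two: "[2 ^ p = (2::int)] (mod int p)"
    using p2 by (simp add: power_Suc[symmetric] del: power_Suc)
  have key: "[(\<Sum>i\<le>p. int (p choose i) * g i) = g 0 + g p] (mod int p)" for g
  proof -
    have "(\<Sum>i\<le>p. int (p choose i) * g i) = g 0 + (g p + (\<Sum>i\<in>{..p} - {0} - {p}. int (p choose i) * g i))"
      using p2 by (subst sum.remove[of _ 0], simp, simp, subst sum.remove[of _ p]) auto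
    moreover have "int p dvd (\<Sum>i\<in>{..p} - {0} - {p}. int (p choose i) * g i)"
      using assms(1) by (intro dvd_sum dvd_mult2) (auto intro!: dvd_choose_prime)
    ultimately show ?thesis
      by (simp add: cong_iff_dvd_diff)
  qed
  have red: "[x = y] (mod int p)" if "2 ^ p * x = 2 * S" "[S = y] (mod int p)" for x y S
  proof -
    have "[2 * x = 2 ^ p * x] (mod int p)"
      using two by (intro cong_mult) (auto simp: cong_sym)
    also have "2 ^ p * x = 2 * S"
      by fact
    also have "[2 * S = 2 * y] (mod int p)"
      using that(2) by (intro cong_mult) auto
    finally show ?thesis
      using cop by (simp add: cong_mult_lcancel)
  qed
  have "p div 2 = (p - 1) div 2"
    using podd by (auto elim!: oddE)
  then have "[(\<Sum>i\<le>p. int (p choose i) * of_bool (odd i) * 5 ^ (i div 2)) = 5 ^ ((p - 1) div 2)] (mod int p)"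
    using key[of "\<lambda>i. of_bool (odd i) * 5 ^ (i div 2)"] podd by (simp add: mult.assoc)
  then show "[int (fib p) = 5 ^ ((p - 1) div 2)] (mod int p)"
    by (rule red[OF two_power_fib(1)])
  have "[(\<Sum>i\<le>p. int (p choose i) * of_bool (even i) * 5 ^ (i div 2)) = 1] (mod int p)"
    using key[of "\<lambda>i. of_bool (even i) * 5 ^ (i div 2)"] podd by (simp add: mult.assoc)
  then show "[2 * int (fib (Suc p)) - int (fib p) = 1] (mod int p)"
    by (rule red[OF two_power_fib(2)])
qed

text \<open>Since 5 is 1 modulo 4, the reciprocity sign is positive and the two Legendre symbols
  agree. The nonzero squares modulo 5 are 1 and 4.\<close>

lemma Legendre_5:
  assumes "prime p" "p \<noteq> 2" "p \<noteq> 5"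
  shows "[int p = 1] (mod 5) \<or> [int p = - 1] (mod 5) \<Longrightarrow> Legendre 5 p = 1"
    and "[int p = 2] (mod 5) \<or> [int p = - 2] (mod 5) \<Longrightarrow> Legendre 5 p = - 1"
proof -
  have p2: "p > 2"
    using assms prime_gt_1_nat[of p] by linarith
  have "Legendre p 5 * Legendre 5 p = (-1::int) ^ ((p - 1) div 2 * ((5 - 1) div 2))"
    using Quadratic_Reciprocity[of p 5] assms p2 by simp
  then have rec: "Legendre p 5 * Legendre 5 p = 1"
    by simp
  show "Legendre 5 p = 1" if "[int p = 1] (mod 5) \<or> [int p = - 1] (mod 5)"
  proof -
    have "[1\<^sup>2 = int p] (mod 5) \<or> [2\<^sup>2 = int p] (mod 5)"
      using that by (auto simp: cong_def)
    then have "QuadRes 5 p"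
      unfolding QuadRes_def by blast
    moreover have "\<not> [int p = 0] (mod 5)"
      using that by (auto simp: cong_def)
    ultimately show ?thesis
      using rec by (simp add: Legendre_def split: if_splits)
  qed
  show "Legendre 5 p = - 1" if "[int p = 2] (mod 5) \<or> [int p = - 2] (mod 5)"
  proof -
    have pm: "int p mod 5 = 2 \<or> int p mod 5 = 3"
      using that by (auto simp: cong_def)
    have "\<not> QuadRes 5 p"
    proof
      assume "QuadRes 5 p"
      then obtain y where "y\<^sup>2 mod 5 = int p mod 5"
        by (auto simp: QuadRes_def cong_def)
      then have "(y mod 5)\<^sup>2 mod 5 = int p mod 5"
        by (simp add: power_mod)
      moreover have "y mod 5 \<in> {0,1,2,3,4}"
        by auto
      ultimately show False
        using pm by auto
    qed
    moreover have "\<not> [int p = 0] (mod 5)"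
      using pm by (auto simp: cong_def)
    ultimately show ?thesis
      using rec by (simp add: Legendre_def split: if_splits)
  qed
qed

text \<open>Euler's criterion gives \<open>fib p\<close> as 1 or -1 modulo \<open>p\<close>.
  Combined with \<open>2 * fib (p + 1) - fib p = 1\<close> modulo \<open>p\<close>, this makes
  \<open>2 * fib (p - 1)\<close> or \<open>2 * fib (p + 1)\<close> vanish, and 2 is
  invertible.\<close>

lemma prime_dvd_fib_pred_or_Suc:
  assumes "prime p" "p \<noteq> 2" "p \<noteq> 5"
  shows "[int p = 1] (mod 5) \<or> [int p = - 1] (mod 5) \<Longrightarrow> p dvd fib (p - 1)"
    and "[int p = 2] (mod 5) \<or> [int p = - 2] (mod 5) \<Longrightarrow> p dvd fib (p + 1)"
proof -
  have p2: "p > 2"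
    using assms prime_gt_1_nat[of p] by linarith
  have "coprime 2 (int p)"
    using assms p2 prime_odd_nat by auto
  then have half: "int p dvd x" if "int p dvd 2 * x" for x
    using that by (simp add: coprime_dvd_mult_right_iff coprime_commute)
  have fp: "[int (fib p) = Legendre 5 p] (mod int p)"
    using fib_prime_cong(1)[OF assms(1,2)] euler_criterion[OF assms(1) p2, of 5]
    by (metis cong_sym cong_trans)
  have lp: "int p dvd 2 * int (fib (Suc p)) - int (fib p) - 1"
    using fib_prime_cong(2)[OF assms(1,2)] by (simp add: cong_iff_dvd_diff)
  show "p dvd fib (p - 1)" if "[int p = 1] (mod 5) \<or> [int p = - 1] (mod 5)"
  proof -
    have "int p dvd int (fib p) - 1"
      using fp Legendre_5(1)[OF assms that] by (simp add: cong_iff_dvd_diff)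
    with lp have "int p dvd 2 * int (fib (Suc p)) - int (fib p) - 1 - (int (fib p) - 1)"
      by (rule dvd_diff)
    also have "fib (Suc p) = fib p + fib (p - 1)"
      using p2 by (cases p rule: fib.cases) auto
    then have "2 * int (fib (Suc p)) - int (fib p) - 1 - (int (fib p) - 1) = 2 * int (fib (p - 1))"
      by simp
    finally show ?thesis
      using half[of "int (fib (p - 1))"] by (simp only: int_dvd_int_iff)
  qed
  show "p dvd fib (p + 1)" if "[int p = 2] (mod 5) \<or> [int p = - 2] (mod 5)"
  proof -
    have "int p dvd int (fib p) + 1"
      using fp Legendre_5(2)[OF assms that] by (simp add: cong_iff_dvd_diff)
    with lp have "int p dvd 2 * int (fib (Suc p)) - int (fib p) - 1 + (int (fib p) + 1)"
      by (rule dvd_add)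
    then show ?thesis
      using half[of "int (fib (Suc p))"] by (simp add: int_dvd_int_iff)
  qed
qed

section \<open>Legendre's formula and digit sums\<close>

text \<open>Used twice: with \<open>z = p\<close> for factorials, and with \<open>z\<close> the rank
  for products of Fibonacci numbers.\<close>

lemma sum_supported_on_multiples:
  fixes f :: "nat \<Rightarrow> 'a::comm_monoid_add"
  assumes "z > 0" "\<And>i. \<not> z dvd i \<Longrightarrow> f i = 0"
  shows "(\<Sum>i = 1..m. f i) = (\<Sum>j = 1..m div z. f (j * z))"
proof (induction m)
  case 0
  show ?case by simp
next
  case (Suc m)
  show ?case
  proof (cases "z dvd Suc m")
    case True
    then have d: "Suc m div z = Suc (m div z)"
      by (simp add: div_Suc dvd_eq_mod_eq_0)
    then have "Suc (m div z) * z = Suc m"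
      using True by (metis dvd_div_mult_self)
    then have "f (Suc (m div z) * z) = f (Suc m)"
      by (rule arg_cong)
    then show ?thesis
      using Suc d by simp
  next
    case False
    then have "Suc m div z = m div z"
      by (simp add: div_Suc dvd_eq_mod_eq_0)
    then show ?thesis
      using Suc assms(2)[OF False] by simp
  qed
qed

lemma multiplicity_fact:
  fixes p :: nat
  assumes "prime p"
  shows "multiplicity p (fact n :: nat) = (\<Sum>i = 1..n. multiplicity p i)"
  unfolding fact_prod of_nat_id using assms by (subst prime_elem_multiplicity_prod_distrib) auto

lemma multiplicity_fact_div:
  fixes p :: nat
  assumes "prime p"
  shows "multiplicity p (fact n :: nat) = n div p + multiplicity p (fact (n div p) :: nat)"
proof -
  have "multiplicity p (fact n :: nat) = (\<Sum>j = 1..n div p. multiplicity p (j * p))"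
    unfolding multiplicity_fact[OF assms]
    using assms by (intro sum_supported_on_multiples) (auto simp: prime_gt_0_nat not_dvd_imp_multiplicity_0)
  also have "\<dots> = (\<Sum>j = 1..n div p. 1 + multiplicity p j)"
    using prime_gt_1_nat[OF assms]
    by (intro sum.cong) (auto simp: mult.commute[of _ p] multiplicity_times_same)
  finally show ?thesis
    unfolding multiplicity_fact[OF assms, of "n div p"] by (simp only: sum.distrib) simp
qed

text \<open>Legendre's formula unrolled \<open>k\<close> times: floors nest, so dividing
  \<open>p ^ Suc k * x div z\<close> by \<open>p\<close> merely lowers the exponent of
  \<open>p\<close> in the numerator.\<close>

lemma multiplicity_fact_power_mult_div:
  fixes p :: nat
  assumes "prime p"
  shows "multiplicity p (fact (p ^ k * x div z) :: nat)
    = (\<Sum>i<k. p ^ i * x div z) + multiplicity p (fact (x div z) :: nat)"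
proof (induction k)
  case 0
  show ?case by simp
next
  case (Suc k)
  have "p ^ Suc k * x div z div p = p ^ k * x div z"
    using prime_gt_0_nat[OF assms]
    by (simp add: div_mult2_eq[symmetric] mult.commute[of z] mult.assoc)
  then show ?case
    using Suc multiplicity_fact_div[OF assms, of "p ^ Suc k * x div z"] by simp
qed

lemma digit_sum_rec:
  assumes "b \<ge> 2" "n > 0"
  shows "digit_sum b n = n mod b + digit_sum b (n div b)"
proof -
  have fin: "finite {i. b ^ i \<le> k}" for k
  proof (rule finite_subset)
    show "{i. b ^ i \<le> k} \<subseteq> {..k}"
    proof
      fix i assume "i \<in> {i. b ^ i \<le> k}"
      moreover have "i < b ^ i"
        using assms(1) by (intro less_exp[THEN less_le_trans] power_mono) auto
      ultimately show "i \<in> {..k}"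
        by simp
    qed
  qed simp
  have *: "b ^ i \<le> n div b \<longleftrightarrow> b ^ Suc i \<le> n" for i
    using assms by (simp add: less_eq_div_iff_mult_less_eq mult.commute)
  have "{i. b ^ i \<le> n} = insert 0 (Suc ` {i. b ^ i \<le> n div b})"
  proof (rule Set.set_eqI)
    fix i
    show "i \<in> {i. b ^ i \<le> n} \<longleftrightarrow> i \<in> insert 0 (Suc ` {i. b ^ i \<le> n div b})"
      using assms * by (cases i) auto
  qed
  then have "digit_sum b n = n mod b + (\<Sum>i\<in>Suc ` {i. b ^ i \<le> n div b}. n div b ^ i mod b)"
    unfolding digit_sum_def using fin by simp
  also have "(\<Sum>i\<in>Suc ` {i. b ^ i \<le> n div b}. n div b ^ i mod b) = digit_sum b (n div b)"
    unfolding digit_sum_def by (subst sum.reindex) (simp_all add: div_mult2_eq)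
  finally show ?thesis .
qed

text \<open>Splitting off the last digit reduces \<open>n\<close> to \<open>n div p\<close>. The
  additive form avoids truncated subtraction.\<close>

lemma legendre_digit_sum:
  fixes p :: nat
  assumes "prime p"
  shows "(p - 1) * multiplicity p (fact n :: nat) + digit_sum p n = n"
proof (induction n rule: less_induct)
  case (less n)
  have p2: "p \<ge> 2"
    using assms by (rule prime_ge_2_nat)
  show ?case
  proof (cases "n = 0")
    case True
    then show ?thesis
      using p2 by (simp add: digit_sum_def)
  next
    case False
    have "(p - 1) * multiplicity p (fact n :: nat) + digit_sum p n
        = (p - 1) * (n div p) + n mod p
          + ((p - 1) * multiplicity p (fact (n div p) :: nat) + digit_sum p (n div p))"
      using digit_sum_rec[OF p2, of n] False multiplicity_fact_div[OF assms, of n]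
      by (simp add: distrib_left)
    also have "\<dots> = (p - 1) * (n div p) + n mod p + n div p"
      using less.IH[of "n div p"] False p2 by simp
    also have "\<dots> = p * (n div p) + n mod p"
      using p2 by (cases p) auto
    finally show ?thesis
      by simp
  qed
qed

section \<open>Quotients and residues modulo the rank\<close>

text \<open>The last summand is the borrow when the residue of \<open>y\<close> is subtracted from
  that of \<open>x\<close>. For \<open>x = p ^ a * n\<close> and \<open>y = n\<close> it becomes the
  condition \<open>r < s\<close> of the theorem.\<close>

lemma div_add_eq_of_bool:
  fixes x y z :: nat
  assumes "z > 0" "y \<le> x"
  shows "x div z = y div z + (x - y) div z + of_bool (x mod z < y mod z)"
proof -
  define q where "q = x div z" 
  define t where "t = x mod z"
  define u where "u = y div z" 
  define v where "v = y mod z"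
  have x: "x = q * z + t" and y: "y = u * z + v" and tv: "t < z" "v < z"
    using assms(1) by (simp_all add: q_def t_def u_def v_def)
  have uq: "u \<le> q"
    using assms(2) by (simp add: u_def q_def div_le_mono)
  show ?thesis
  proof (cases "t < v")
    case True
    have "u \<noteq> q" using True assms(2) x y by auto
    with uq obtain d where d: "q = u + Suc d"
      by (metis add_Suc_right le_neq_implies_less less_imp_Suc_add)
    have "x - y = d * z + (z + t - v)"
      using tv True unfolding x y d by (simp add: algebra_simps)
    moreover have "z + t - v < z" using True tv by linarith
    ultimately have "(x - y) div z = d"
      by (metis add.commute div_less div_mult_self3 add_0_right less_nat_zero_code)
    then show ?thesis
      using True d by (simp add: q_def t_def u_def v_def)
  next
    case False
    obtain d where d: "q = u + d"
      using uq by (metis le_add_diff_inverse)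
    have "x - y = d * z + (t - v)"
      using tv False unfolding x y d by (simp add: algebra_simps)
    moreover have "t - v < z" using tv by linarith
    ultimately have "(x - y) div z = d"
      by (metis add.commute div_less div_mult_self3 add_0_right less_nat_zero_code)
    then show ?thesis
      using False d by (simp add: q_def t_def u_def v_def)
  qed
qed

lemma sum_power_mult_mod_1:
  fixes p z x :: nat
  assumes "[p = 1] (mod z)"
  shows "(\<Sum>i<k. p ^ i * x mod z) = k * (x mod z)"
proof -
  have "p ^ i * x mod z = x mod z" for i
    using cong_mult[OF cong_pow[OF assms] cong_refl, of i x] by (simp add: cong_def)
  then show ?thesis by simp
qed

text \<open>The sum of the two residues is a multiple of \<open>z\<close> below
  \<open>2 * z\<close>, hence 0 or \<open>z\<close>.\<close>

lemma mod_add_mult_mod: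
  fixes p z x :: nat
  assumes "z dvd p + 1"
  shows "x mod z + p * x mod z = z * of_bool (x mod z \<noteq> 0)"
proof -
  have z: "z > 0"
    using assms by (cases "z = 0") auto
  have "z dvd x + p * x"
    using dvd_mult2[OF assms, of x] by (simp add: algebra_simps)
  then have dvd: "z dvd x mod z + p * x mod z"
    by (simp add: mod_add_eq dvd_eq_mod_eq_0)
  show ?thesis
  proof (cases "x mod z = 0")
    case True
    then have "p * x mod z = 0"
      by auto
    with True show ?thesis by simp
  next
    case False
    obtain q where q: "x mod z + p * x mod z = z * q"
      using dvd ..
    have "x mod z < z" "p * x mod z < z"
      using z by auto
    then have "z * q < z * 2"
      unfolding q[symmetric] by linarith
    moreover have "q \<noteq> 0" using False q by (intro notI) simp
    ultimately have "q = 1"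
      by simp
    with q False show ?thesis by simp
  qed
qed

lemma power_mult_mod_minus_1:
  fixes p z x :: nat
  assumes "z dvd p + 1"
  shows "p ^ i * x mod z = (if even i then x mod z else p * x mod z)"
proof -
  have z: "z > 0"
    using assms by (cases "z = 0") auto
  \<comment> \<open>Multiplying by \<open>p\<close> replaces a nonzero residue by its complement to
    \<open>z\<close>; doing so twice restores it.\<close>
  have sq: "p * (p * y) mod z = y mod z" for y
    using mod_add_mult_mod[OF assms, of y] mod_add_mult_mod[OF assms, of "p * y"]
      mod_less_divisor[OF z, of y] mod_less_divisor[OF z, of "p * y"]
    by (cases "y mod z = 0"; cases "p * y mod z = 0") (auto simp del: mod_less_divisor)
  have per: "p ^ (2 * j) * x mod z = x mod z" for j
    by (induction j) (simp_all add: sq mult.assoc)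
  show ?thesis
  proof (cases "even i")
    case True
    then show ?thesis
      using per by (auto elim!: evenE)
  next
    case False
    then obtain j where "i = Suc (2 * j)"
      by (auto elim: oddE)
    then have "p ^ i * x mod z = p * (p ^ (2 * j) * x) mod z"
      by (simp add: mult.assoc)
    also have "\<dots> = p * x mod z"
      by (metis per mod_mult_right_eq)
    finally show ?thesis
      using False by simp
  qed
qed

text \<open>Consecutive exponents pair off, each pair contributing 0 or \<open>z\<close>. For odd
  \<open>k\<close> the unpaired exponent \<open>k - 1\<close> is even, so it leaves
  \<open>x mod z\<close>.\<close>

lemma sum_power_mult_mod_minus_1:
  fixes p z x :: nat
  assumes "z dvd p + 1"
  shows "(\<Sum>i<k. p ^ i * x mod z)
    = (k div 2) * (z * of_bool (x mod z \<noteq> 0)) + of_bool (odd k) * (x mod z)"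
proof -
  note pow = power_mult_mod_minus_1[OF assms, of _ x]
  have even: "(\<Sum>i<2 * j. p ^ i * x mod z) = j * (z * of_bool (x mod z \<noteq> 0))" for j
  proof (induction j)
    case (Suc j)
    then show ?case
      using pow[of "2 * j"] pow[of "Suc (2 * j)"] mod_add_mult_mod[OF assms, of x] by simp
  qed simp
  show ?thesis
  proof (cases "even k")
    case True
    then show ?thesis
      using even[of "k div 2"] by simp
  next
    case False
    then obtain j where "k = Suc (2 * j)"
      by (auto elim: oddE)
    then show ?thesis
      using even[of j] pow[of "2 * j"] by simp
  qed
qed

section \<open>The exponent of a prime in Fibonomial coefficients\<close>

lemma multiplicity_fib_fact:
  fixes p :: nat
  assumes "prime p" "p \<noteq> 2" "0 < t" "p dvd fib t"
  shows "multiplicity p (fib_fact m) = multiplicity p (fib (fib_rank p)) * (m div fib_rank p)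
    + multiplicity p (fact (m div fib_rank p) :: nat)"
proof -
  let ?z = "fib_rank p"
  note rank = fib_rank_dvd_iff[OF assms(3,4)]
  have "fib i \<noteq> 0" if "i \<in> {1..m}" for i
    using fib_neq_0_nat[of i] that by simp
  then have "0 \<notin> fib ` {1..m}"
    by (metis imageE)
  then have "multiplicity p (fib_fact m) = (\<Sum>i = 1..m. multiplicity p (fib i))"
    unfolding fib_fact_def using assms(1)
    by (intro prime_elem_multiplicity_prod_distrib) simp_all
  also have "\<dots> = (\<Sum>j = 1..m div ?z. multiplicity p (fib (j * ?z)))"
    using rank by (intro sum_supported_on_multiples) (auto simp: not_dvd_imp_multiplicity_0)
  also have "\<dots> = (\<Sum>j = 1..m div ?z. multiplicity p (fib ?z) + multiplicity p j)"
    using assms(1,2) rank by (intro sum.cong multiplicity_fib_mult) auto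
  finally show ?thesis
    unfolding multiplicity_fact[OF assms(1)] by (simp add: sum.distrib)
qed

lemma multiplicity_fibonomial:
  fixes p :: nat
  assumes "prime p" "j \<le> m"
  shows "multiplicity p (fib_fact m) = multiplicity p (fibonomial m j)
    + multiplicity p (fib_fact j) + multiplicity p (fib_fact (m - j))"
proof -
  have "fib_fact j * fib_fact (m - j) dvd fib_fact m"
    using fib_fact_mult_dvd[of j "m - j"] assms(2) by simp
  then have eq: "fib_fact m = fibonomial m j * (fib_fact j * fib_fact (m - j))"
    by (simp add: fibonomial_def)
  moreover from eq have "fibonomial m j \<noteq> 0"
    using fib_fact_pos[of m] by (intro notI) simp
  moreover have "fib_fact j \<noteq> 0" "fib_fact (m - j) \<noteq> 0"
    using fib_fact_pos by simp_all
  ultimately show ?thesis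
    using assms(1) by (simp add: prime_elem_multiplicity_mult_distrib)
qed

lemma sum_power_mult_div_mod:
  fixes p x z :: nat
  shows "z * (\<Sum>i<k. p ^ i * x div z) + (\<Sum>i<k. p ^ i * x mod z) = x * (\<Sum>i<k. p ^ i)"
proof -
  have "z * (\<Sum>i<k. p ^ i * x div z) + (\<Sum>i<k. p ^ i * x mod z)
      = (\<Sum>i<k. z * (p ^ i * x div z) + p ^ i * x mod z)"
    by (simp only: sum_distrib_left sum.distrib)
  also have "\<dots> = (\<Sum>i<k. p ^ i * x)"
    by simp
  finally show ?thesis
    by (simp add: sum_distrib_left mult.commute)
qed

lemma geometric_sum_nat:
  fixes p :: nat
  assumes "p > 0"
  shows "(p - 1) * (\<Sum>i<k. p ^ i) = p ^ k - 1"
proof -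
  obtain q where q: "p = Suc q"
    using assms gr0_implies_Suc by blast
  have "q * (\<Sum>i<k. p ^ i) + 1 = p ^ k"
    by (induction k) (simp_all add: q algebra_simps)
  then show ?thesis
    by (simp add: q)
qed

text \<open>The quotients \<open>p ^ i * n div z\<close> and \<open>p ^ i * M div z\<close> produced by Legendre's formula are
  traded for residues; the geometric sums then combine to \<open>m * (1 + p + \<dots> + p ^ (a - 1))\<close>.\<close>

lemma multiplicity_fibonomial_residues:
  fixes p a k m n z M :: nat
  assumes "prime p" "p \<noteq> 2" "0 < t" "p dvd fib t"
  defines "z \<equiv> fib_rank p" and "n \<equiv> p ^ k * m" and "M \<equiv> m * (p ^ a - 1)"
  shows "z * (multiplicity p (fibonomial (p ^ a * n) n) + multiplicity p (fact (M div z) :: nat))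
      + (\<Sum>i<a. p ^ i * n mod z)
    = z * (multiplicity p (fib z) * of_bool (p ^ a * n mod z < n mod z))
      + m * (\<Sum>i<a. p ^ i) + (\<Sum>i<k. p ^ i * M mod z)"
proof -
  have p0: "p > 0"
    using assms(1) prime_gt_0_nat by blast
  have z0: "z > 0"
    unfolding z_def by (rule fib_rank_dvd_iff(2)[OF assms(3,4)])
  let ?N = "p ^ a * n" and ?V = "multiplicity p (fibonomial (p ^ a * n) n)"
    and ?e = "multiplicity p (fib z)" and ?ob = "of_bool (p ^ a * n mod z < n mod z) :: nat"
  let ?f = "\<lambda>x. multiplicity p (fact x :: nat)"
  let ?G = "\<lambda>k. \<Sum>i<k. p ^ i"
  note ff = multiplicity_fib_fact[OF assms(1-4), folded z_def]
  have nN: "n \<le> ?N"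
    using p0 by simp
  \<comment> \<open>Splitting off \<open>p ^ k\<close> lets Legendre's formula stop at
    \<open>fact (M div z)\<close>; this quotient is the \<open>A\<close> of the theorem.\<close>
  have diff: "?N - n = p ^ k * M"
    by (simp add: n_def M_def algebra_simps)
  have "?e * (?N div z) + ?f (?N div z)
      = ?V + (?e * (n div z) + ?f (n div z)) + (?e * ((?N - n) div z) + ?f ((?N - n) div z))"
    using multiplicity_fibonomial[OF assms(1) nN] by (simp only: ff)
  moreover have "?N div z = n div z + (?N - n) div z + ?ob"
    by (rule div_add_eq_of_bool[OF z0 nN])
  then have "?e * (?N div z) = ?e * (n div z) + ?e * ((?N - n) div z) + ?e * ?ob"
    by (simp only: distrib_left)
  moreover have "?f (?N div z) = (\<Sum>i<a. p ^ i * n div z) + ?f (n div z)"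
    by (rule multiplicity_fact_power_mult_div[OF assms(1)])
  moreover have "?f ((?N - n) div z) = (\<Sum>i<k. p ^ i * M div z) + ?f (M div z)"
    unfolding diff by (rule multiplicity_fact_power_mult_div[OF assms(1)])
  \<comment> \<open>The factorial of \<open>n div z\<close> cancels, and of the terms with factor
    \<open>?e\<close> only the borrow survives.\<close>
  ultimately have "?V + ?f (M div z) + (\<Sum>i<k. p ^ i * M div z)
      = ?e * ?ob + (\<Sum>i<a. p ^ i * n div z)"
    by linarith
  then have "z * (?V + ?f (M div z) + (\<Sum>i<k. p ^ i * M div z))
      = z * (?e * ?ob + (\<Sum>i<a. p ^ i * n div z))"
    by (rule arg_cong)
  then have 1: "z * (?V + ?f (M div z)) + z * (\<Sum>i<k. p ^ i * M div z)
      = z * (?e * ?ob) + z * (\<Sum>i<a. p ^ i * n div z)"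
    by (simp only: distrib_left)
  \<comment> \<open>Here \<open>p ^ k\<close> is written as \<open>(p ^ k - 1) + 1\<close>; the
    factor \<open>p - 1\<close> of \<open>p ^ k - 1\<close> is then moved from \<open>?G k\<close>
    to \<open>?G a\<close>, which produces \<open>M\<close>.\<close>
  have "n * ?G a = m * ?G a * (p ^ k - 1) + m * ?G a"
    using p0 by (cases "p ^ k") (simp_all add: n_def algebra_simps)
  also have "m * ?G a * (p ^ k - 1) = m * (p ^ a - 1) * ?G k"
    unfolding geometric_sum_nat[OF p0, symmetric] by (simp only: mult_ac)
  finally have 2: "n * ?G a = M * ?G k + m * ?G a"
    by (simp only: M_def)
  show ?thesis
    using 1 2 sum_power_mult_div_mod[where p = p and x = n and z = z and k = a]
      sum_power_mult_div_mod[where p = p and x = M and z = z and k = k]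
    by linarith
qed

section \<open>Specialisation to the three cases\<close>

lemma frac_of_nat_div:
  assumes "z > 0"
  shows "frac (real m / real z) = real (m mod z) / real z"
proof -
  have "real m = real (z * (m div z) + m mod z)"
    by simp
  then have "real m = real z * real (m div z) + real (m mod z)"
    by (simp only: of_nat_add of_nat_mult)
  then show ?thesis
    unfolding frac_def floor_divide_of_nat_eq using assms by (simp add: field_simps)
qed

lemma digit_sum_real:
  fixes p :: nat
  assumes "prime p"
  shows "real A / (real p - 1) - real (multiplicity p (fact A :: nat)) = real (digit_sum p A) / (real p - 1)"
proof -
  have "p > 1"
    using assms by (rule prime_gt_1_nat)
  have "real ((p - 1) * multiplicity p (fact A :: nat) + digit_sum p A) = real A"
    using legendre_digit_sum[OF assms, of A] by simp
  then show ?thesis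
    using \<open>p > 1\<close> by (simp add: field_simps)
qed

text \<open>For odd \<open>a\<close> the residues of \<open>m\<close> and \<open>p * m\<close> are
  \<open>s\<close> and \<open>r\<close> in an order decided by the parity of \<open>k\<close>, and
  \<open>M\<close> is their difference modulo \<open>z\<close>. The bracket on the right is the part
  of \<open>\<delta>\<close> that does not involve the exponent of \<open>p\<close> in
  \<open>fib z\<close>.\<close>

lemma residue_sum_odd_exponent:
  fixes p z m k a r s M :: nat
  assumes "z dvd p + 1" "odd a" "p > 0"
  defines "r \<equiv> p ^ a * (p ^ k * m) mod z" and "s \<equiv> p ^ k * m mod z" and "M \<equiv> m * (p ^ a - 1)"
  shows "m mod z + (\<Sum>i<k. p ^ i * M mod z)
    = s + z * ((k div 2 + of_bool (odd k) * of_bool (r > s)) * of_bool (r \<noteq> s))"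
proof -
  have z: "z > 0"
    using assms(1) by (cases "z = 0") auto
  define t where "t = m mod z"
  define t' where "t' = p * m mod z"
  have lt: "t < z" "t' < z"
    using z by (simp_all add: t_def t'_def)
  note pow = power_mult_mod_minus_1[OF assms(1)]
  have s: "s = (if even k then t else t')"
    by (simp add: s_def pow t_def t'_def)
  have "r = p ^ (a + k) * m mod z"
    by (simp add: r_def power_add mult.assoc)
  then have r: "r = (if even k then t' else t)"
    using assms(2) by (simp add: pow t_def t'_def)
  have "M + m = p ^ a * m"
    using assms(3) by (cases "p ^ a") (auto simp: M_def algebra_simps)
  then have "(M mod z + t) mod z = t'"
    using assms(2) pow[of a m] by (simp add: t_def t'_def mod_simps)
  moreover define u where "u = M mod z"
  ultimately have ut: "(u + t) mod z = t'"
    by simp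
  have u: "u < z"
    using z by (simp add: u_def)
  have M: "u + t = t' + z * of_bool (t' < t)"
  proof (cases "u + t < z")
    case True
    with ut have "u + t = t'"
      by (simp only: mod_less)
    then show ?thesis
      by simp
  next
    case False
    then have "(u + t) mod z = u + t - z"
      using lt u by (simp add: le_mod_geq)
    with ut False have "u + t = t' + z"
      by linarith
    with u show ?thesis
      by simp
  qed
  \<comment> \<open>This turns the indicator of a nonzero residue of \<open>M\<close> into the
    factor for \<open>r \<noteq> s\<close>.\<close>
  have M0: "u \<noteq> 0 \<longleftrightarrow> t \<noteq> t'"
  proof (cases "t' < t")
    case True
    then have "u \<noteq> 0"
      using M lt by (intro notI) simp
    with True show ?thesis
      by simp
  next
    case False
    with M show ?thesis
      by auto
  qed
  have "t + (k div 2 * (z * of_bool (t \<noteq> t')) + of_bool (odd k) * u)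
    = s + z * ((k div 2 + of_bool (odd k) * of_bool (r > s)) * of_bool (r \<noteq> s))"
  proof (cases "even k")
    case True
    then show ?thesis
      by (simp add: s r algebra_simps)
  next
    case False
    \<comment> \<open>For odd \<open>k\<close> the unpaired \<open>u\<close> carries
      \<open>t\<close> to \<open>t'\<close>, which is now \<open>s\<close>; the borrow in
      \<open>M\<close> supplies the indicator of \<open>r > s\<close>.\<close>
    have "t + (k div 2 * (z * of_bool (t \<noteq> t')) + u)
        = t' + z * ((k div 2 + of_bool (t > t')) * of_bool (t \<noteq> t'))"
      using M by (cases "t = t'"; cases "t' < t") (simp_all add: algebra_simps)
    with False show ?thesis
      by (simp add: s r)
  qed
  then show ?thesis
    unfolding sum_power_mult_mod_minus_1[OF assms(1)] u_def[symmetric] t_def[symmetric] M0 .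
qed

theorem theorem12:
  fixes p a n r s A :: nat and \<delta> :: int
  assumes "prime p" and "p \<noteq> 2" and "p \<noteq> 5"
    and "a > 0" and "n > 0"
    and "r = (p ^ a * n) mod fib_rank p"
    and "s = n mod fib_rank p"
    and "A = nat \<lfloor>(real n * (real p ^ a - 1)) / (real p ^ multiplicity p n * real (fib_rank p))\<rfloor>"
    and "\<delta> = (\<lfloor>real (multiplicity p n) / 2\<rfloor>
              + of_bool (\<not> 2 dvd multiplicity p n) * of_bool (r > s)
              + of_bool (r < s) * int (multiplicity p (fib (fib_rank p)))) * of_bool (r \<noteq> s)"
  shows
    "([int p = 1] (mod 5) \<or> [int p = - 1] (mod 5) \<longrightarrow>
       real (multiplicity p (fibonomial (p ^ a * n) n))
         = real A / (real p - 1)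
           - real a * frac (real n / (real p ^ multiplicity p n * real (fib_rank p)))
           - real (multiplicity p (fact A :: nat))
       \<and> real A / (real p - 1)
           - real a * frac (real n / (real p ^ multiplicity p n * real (fib_rank p)))
           - real (multiplicity p (fact A :: nat))
         = real (digit_sum p A) / (real p - 1)
           - real a * frac (real n / (real p ^ multiplicity p n * real (fib_rank p))))
     \<and> (([int p = 2] (mod 5) \<or> [int p = - 2] (mod 5)) \<and> even a \<longrightarrow>
       real (multiplicity p (fibonomial (p ^ a * n) n))
         = real A / (real p - 1) - real a / 2 * of_bool (s \<noteq> 0)
           - real (multiplicity p (fact A :: nat))
       \<and> real A / (real p - 1) - real a / 2 * of_bool (s \<noteq> 0)
           - real (multiplicity p (fact A :: nat))
         = real (digit_sum p A) / (real p - 1) - real a / 2 * of_bool (s \<noteq> 0))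
     \<and> (([int p = 2] (mod 5) \<or> [int p = - 2] (mod 5)) \<and> odd a \<longrightarrow>
       real (multiplicity p (fibonomial (p ^ a * n) n))
         = real_of_int \<lfloor>real A / (real p - 1)\<rfloor> - (real a - 1) / 2 * of_bool (s \<noteq> 0)
           - real (multiplicity p (fact A :: nat)) + real_of_int \<delta>
       \<and> (r = s \<longrightarrow> \<delta> = 0)
       \<and> (r < s \<longrightarrow>
            \<delta> = \<lfloor>real (multiplicity p n) / 2\<rfloor> + int (multiplicity p (fib (fib_rank p))))
       \<and> (r > s \<longrightarrow> \<delta> = \<lceil>real (multiplicity p n) / 2\<rceil>))"
proof -
  define z where "z = fib_rank p"
  define k where "k = multiplicity p n"
  have p1: "p > 1"
    using assms(1) by (rule prime_gt_1_nat)
  obtain m where nm: "n = p ^ k * m"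
    unfolding k_def using multiplicity_dvd[of p n] by blast
  define M where "M = m * (p ^ a - 1)"
  define G where "G = (\<Sum>i<a. p ^ i)"
  have MG: "M = m * G * (p - 1)"
    using geometric_sum_nat[of p a] p1 by (simp add: M_def G_def mult_ac)
  have pa: "real (p ^ a - 1) = real p ^ a - 1"
    using p1 by (simp add: of_nat_diff)
  \<comment> \<open>Cancelling \<open>p ^ k\<close> turns the real floor in \<open>A\<close> into a
    quotient of natural numbers.\<close>
  have "real n * (real p ^ a - 1) / (real p ^ k * real z) = real M / real z"
    unfolding M_def of_nat_mult of_nat_power pa nm using p1 by simp
  then have A: "A = M div z"
    using assms(8) by (simp add: z_def[symmetric] k_def[symmetric] floor_divide_of_nat_eq)
  let ?V = "multiplicity p (fibonomial (p ^ a * n) n)"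
  let ?vA = "multiplicity p (fact A :: nat)"
  \<comment> \<open>The index \<open>t\<close> stays open here: it will be \<open>p - 1\<close> in
    case (i) and \<open>p + 1\<close> in cases (ii) and (iii).\<close>
  have main: "z * (?V + ?vA) + (\<Sum>i<a. p ^ i * n mod z)
      = z * (multiplicity p (fib z) * of_bool (r < s)) + m * G + (\<Sum>i<k. p ^ i * M mod z)"
    if "0 < t" "p dvd fib t" for t
    using multiplicity_fibonomial_residues[OF assms(1,2) that, of a k m]
    unfolding A G_def M_def assms(6,7) z_def nm .
  have zpos: "z > 0" if "0 < t" "p dvd fib t" for t
    using fib_rank_dvd_iff(2)[OF that] by (simp add: z_def)
  \<comment> \<open>If \<open>z\<close> divides \<open>M\<close>, the floor in \<open>A\<close>
    loses nothing, and \<open>p - 1\<close> cancels against the same factor of \<open>M\<close>.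
    This covers cases (i) and (ii).\<close>
  have exact: "real A / (real p - 1) = real (m * G) / real z" if "z dvd M" "z > 0"
  proof -
    have "real A = real M / real z"
      using that by (simp add: A real_of_nat_div)
    also have "real M = real (m * G) * (real p - 1)"
      using p1 by (simp add: MG of_nat_diff)
    finally show ?thesis
      using p1 by simp
  qed
  note ds = digit_sum_real[OF assms(1), of A]
  have i: "real ?V = real A / (real p - 1) - real a * frac (real n / (real p ^ k * real z)) - real ?vA"
    if cong: "[int p = 1] (mod 5) \<or> [int p = - 1] (mod 5)"
  proof -
    have dvd: "p dvd fib (p - 1)" and t0: "0 < p - 1"
      using prime_dvd_fib_pred_or_Suc(1)[OF assms(1-3) cong] p1 by auto
    note z0 = zpos[OF t0 dvd]
    have zp: "z dvd p - 1"
      using fib_rank_dvd_iff(1)[OF t0 dvd] dvd by (simp add: z_def)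
    then have p1z: "[p = 1] (mod z)"
      using p1 by (simp add: cong_altdef_nat)
    have "z dvd M"
      using zp by (simp add: MG)
    have pow: "p ^ i * x mod z = x mod z" for i x
      using cong_mult[OF cong_pow[OF p1z] cong_refl, of i x] by (simp add: cong_def)
    have rs: "r = s"
      unfolding assms(6,7) z_def[symmetric] by (rule pow)
    \<comment> \<open>Multiplication by \<open>p\<close> fixes all residues modulo \<open>z\<close>:
      there is no borrow, the residues of \<open>M\<close> are 0, and each of the \<open>a\<close>
      residues of \<open>n\<close> equals \<open>m mod z\<close>.\<close>
    have "z * (?V + ?vA) + a * (m mod z) = m * G"
      using main[OF t0 dvd] \<open>z dvd M\<close> pow[of k m]
      by (simp add: rs sum_power_mult_mod_1[OF p1z] nm)
    then have "real (z * (?V + ?vA) + a * (m mod z)) = real (m * G)"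
      by (rule arg_cong)
    then have "real ?V = real (m * G) / real z - real a * (real (m mod z) / real z) - real ?vA"
      using z0 by (simp add: field_simps)
    moreover have "real n / (real p ^ k * real z) = real m / real z"
      using p1 by (simp add: nm)
    ultimately show ?thesis
      using exact[OF \<open>z dvd M\<close> z0] frac_of_nat_div[OF z0, of m] by simp
  qed
  have ii_iii: "p dvd fib (p + 1)" "z dvd p + 1" "z > 0"
    if cong: "[int p = 2] (mod 5) \<or> [int p = - 2] (mod 5)"
  proof -
    show dvd: "p dvd fib (p + 1)"
      using prime_dvd_fib_pred_or_Suc(2)[OF assms(1-3) cong] .
    show "z dvd p + 1"
      using fib_rank_dvd_iff(1)[OF _ dvd] dvd by (simp add: z_def)
    show "z > 0"
      using zpos[OF _ dvd] by simp
  qed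
  have ii: "real ?V = real A / (real p - 1) - real a / 2 * of_bool (s \<noteq> 0) - real ?vA"
    if cong: "[int p = 2] (mod 5) \<or> [int p = - 2] (mod 5)" and "even a"
  proof -
    note fz = ii_iii[OF cong]
    note pow = power_mult_mod_minus_1[OF fz(2)]
    \<comment> \<open>An even number of sign changes again gives \<open>z dvd M\<close> and
      \<open>r = s\<close>; the \<open>a\<close> residues of \<open>n\<close> now form
      \<open>a div 2\<close> complementary pairs.\<close>
    have "p ^ a * m mod z = m mod z"
      using pow[of a m] \<open>even a\<close> by simp
    then have "z dvd p ^ a * m - m"
      using p1 by (subst mod_eq_dvd_iff_nat[symmetric]) simp_all
    then have "z dvd M"
      by (simp add: M_def diff_mult_distrib2 mult.commute)
    then have "(\<Sum>i<k. p ^ i * M mod z) = 0"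
      by simp
    moreover have rs: "r = s"
      unfolding assms(6,7) z_def[symmetric] using pow[of a n] \<open>even a\<close> by simp
    ultimately have "z * (?V + ?vA) + (a div 2) * (z * of_bool (s \<noteq> 0)) = m * G"
      using main[OF _ fz(1)] \<open>even a\<close>
      by (simp add: sum_power_mult_mod_minus_1[OF fz(2)] assms(7) z_def[symmetric])
    then have "real (z * (?V + ?vA) + (a div 2) * (z * of_bool (s \<noteq> 0))) = real (m * G)"
      by (rule arg_cong)
    moreover have "real (a div 2) = real a / 2"
      using \<open>even a\<close> by (simp add: real_of_nat_div)
    ultimately have "real ?V = real (m * G) / real z - real a / 2 * of_bool (s \<noteq> 0) - real ?vA"
      using fz(3) by (simp add: field_simps)
    then show ?thesis
      using exact[OF \<open>z dvd M\<close> fz(3)] by simp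
  qed
  have fl: "\<lfloor>real k / 2\<rfloor> = int (k div 2)"
    using floor_divide_of_nat_eq[of k 2] by simp
  have cl: "\<lceil>real k / 2\<rceil> = int (k div 2) + of_bool (odd k)"
    by (cases "even k") (auto elim!: evenE oddE simp: ceiling_eq_iff)
  let ?e = "multiplicity p (fib z)"
  \<comment> \<open>The condition \<open>r < s\<close> implies \<open>r \<noteq> s\<close>, so the
    outer factor is kept only on the summand that \<open>residue_sum_odd_exponent\<close>
    delivers.\<close>
  have \<delta>: "\<delta> = int (((k div 2 + of_bool (odd k) * of_bool (r > s)) * of_bool (r \<noteq> s))
      + ?e * of_bool (r < s))"
    unfolding assms(9) k_def[symmetric] z_def[symmetric] fl by auto
  have iii: "real ?V = real_of_int \<lfloor>real A / (real p - 1)\<rfloor> - (real a - 1) / 2 * of_bool (s \<noteq> 0)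
      - real ?vA + real_of_int \<delta>"
    if cong: "[int p = 2] (mod 5) \<or> [int p = - 2] (mod 5)" and "odd a"
  proof -
    note fz = ii_iii[OF cong]
    have "real p - 1 = real (p - 1)"
      using p1 by (simp add: of_nat_diff)
    then have "\<lfloor>real A / (real p - 1)\<rfloor> = int (A div (p - 1))"
      by (simp only: floor_divide_of_nat_eq)
    \<comment> \<open>For odd \<open>a\<close>, \<open>z\<close> need not divide \<open>M\<close>,
      so the floor remains. Dividing \<open>M = m * G * (p - 1)\<close> by \<open>p - 1\<close>
      before \<open>z\<close> gives the same nested quotient.\<close>
    also have "A div (p - 1) = m * G div z"
      using p1 by (simp add: A MG div_mult2_eq[symmetric])
    finally have Q: "\<lfloor>real A / (real p - 1)\<rfloor> = int (m * G div z)" .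
    \<comment> \<open>Among the \<open>a\<close> residues of \<open>p ^ i * m\<close> all but one
      pair off to multiples of \<open>z\<close>.\<close>
    have "m * G mod z = (\<Sum>i<a. p ^ i * m) mod z"
      by (simp add: G_def sum_distrib_left mult.commute)
    also have "\<dots> = (\<Sum>i<a. p ^ i * m mod z) mod z"
      by (simp add: mod_sum_eq)
    also have "\<dots> = m mod z"
      using \<open>odd a\<close> by (simp add: sum_power_mult_mod_minus_1[OF fz(2)])
    finally have mG: "m * G = z * (m * G div z) + m mod z"
      by (metis mult_div_mod_eq)
    have "m mod z + (\<Sum>i<k. p ^ i * M mod z)
        = s + z * ((k div 2 + of_bool (odd k) * of_bool (r > s)) * of_bool (r \<noteq> s))"
      unfolding assms(6,7) z_def[symmetric] nm M_def
      using p1 by (intro residue_sum_odd_exponent[OF fz(2) \<open>odd a\<close>]) simp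
    moreover have "(\<Sum>i<a. p ^ i * n mod z) = (a div 2) * (z * of_bool (s \<noteq> 0)) + s"
      using \<open>odd a\<close> by (simp add: sum_power_mult_mod_minus_1[OF fz(2)] assms(7) z_def[symmetric])
    \<comment> \<open>The unpaired residue \<open>s\<close> occurs on both sides and cancels, so all
      remaining terms are multiples of \<open>z\<close>.\<close>
    ultimately have "z * (?V + ?vA) + (a div 2) * (z * of_bool (s \<noteq> 0))
        = z * (?e * of_bool (r < s)) + z * (m * G div z)
          + z * ((k div 2 + of_bool (odd k) * of_bool (r > s)) * of_bool (r \<noteq> s))"
      using main[OF add_pos_pos fz(1)] prime_gt_0_nat[OF assms(1)] mG by linarith
    then have "z * (?V + ?vA + (a div 2) * of_bool (s \<noteq> 0))
        = z * (?e * of_bool (r < s) + m * G div z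
          + (k div 2 + of_bool (odd k) * of_bool (r > s)) * of_bool (r \<noteq> s))"
      by (simp only: distrib_left mult.left_commute)
    then have "?V + ?vA + (a div 2) * of_bool (s \<noteq> 0) = ?e * of_bool (r < s) + m * G div z
          + (k div 2 + of_bool (odd k) * of_bool (r > s)) * of_bool (r \<noteq> s)"
      using fz(3) by (simp only: mult_cancel1) simp
    then have "real ?V + real ?vA + real ((a div 2) * of_bool (s \<noteq> 0)) = real (m * G div z)
        + real ((k div 2 + of_bool (odd k) * of_bool (r > s)) * of_bool (r \<noteq> s) + ?e * of_bool (r < s))"
      unfolding of_nat_add[symmetric] of_nat_eq_iff by (simp only: add_ac)
    then have "real ?V + real ?vA + real ((a div 2) * of_bool (s \<noteq> 0))
        = real (m * G div z) + real_of_int \<delta>"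
      by (simp only: \<delta> of_int_of_nat_eq)
    moreover have "real ((a div 2) * of_bool (s \<noteq> 0)) = (real a - 1) / 2 * of_bool (s \<noteq> 0)"
      using \<open>odd a\<close> by (auto elim!: oddE)
    ultimately show ?thesis
      unfolding Q of_int_of_nat_eq by linarith
  qed
  show ?thesis
    unfolding k_def[symmetric] z_def[symmetric]
  proof (intro conjI impI)
    show "\<delta> = 0" if "r = s"
      using that by (simp add: \<delta>)
    show "\<delta> = \<lfloor>real k / 2\<rfloor> + int ?e" if "r < s"
      using that by (simp add: \<delta> fl)
    show "\<delta> = \<lceil>real k / 2\<rceil>" if "s < r"
      using that by (simp add: \<delta> cl)
  qed (insert i ii iii ds, blast, linarith, blast, linarith, blast)
qed

end
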